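(* Let $B$ be an $n\times n$ exchange matrix of finite type. Then $\mathcal P^B_\lambda=\{\lambda\}$ for all $\lambda\in\mathbb R^n$.
   Context: **Mutation.** An exchange matrix is an integer $n\times n$ matrix $B=(b_{ij})$ for which there are positive $d_1,\dots,d_n$ with $d_ib_{ij}=-d_jb_{ji}$. Write $[a]_+=\max(a,0)$. The mutation $\mu_k(B)=(b'_{ij})$ has $b'_{ij}=-b_{ij}$ if $k\in\{i,j\}$ and $b'_{ij}=b_{ij}+\operatorname{sgn}(b_{ik})[b_{ik}b_{kj}]_+$ otherwise. A sequence $\boldsymbol k=k_r\cdots k_1$ of indices in $\{1,\dots,n\}$ is applied from right to left: $\mu_{\boldsymbol k}(B)=\mu_{k_r}(\cdots\mu_{k_1}(B)\cdots)$. **Mutation maps.** For $x\in\mathbb R^n$, $\eta_k^{B^T}(x)$ is obtained by adjoining $x$ as an extra column to the right of $B$ and mutating at $k$: the $k$-th entry becomes $-x_k$ and the $i$-th entry ($i\ne k$) becomes $x_i+\operatorname{sgn}(b_{ik})[b_{ik}x_k]_+$. For $\boldsymbol k=k_r\cdots k_1$ and $B_p=\mu_{k_p\cdots k_1}(B)$, $\eta_{\boldsymbol k}^{B^T}=\eta_{k_r}^{B_{r-1}^T}\circ\cdots\circ\eta_{k_1}^{B_0^T}$ (with $B_0=B$), a piecewise linear homeomorphism of $\mathbb R^n$. **Dominance region.** $\mathcal P^B_{\lambda,\boldsymbol k}=(\eta_{\boldsymbol k}^{B^T})^{-1}\{\eta_{\boldsymbol k}^{B^T}(\lambda)+\mu_{\boldsymbol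 k}(B)\alpha:\alpha\in\mathbb R^n,\alpha\ge0\}$ (componentwise inequality) and $\mathcal P^B_\lambda=\bigcap_{\boldsymbol k}\mathcal P^B_{\lambda,\boldsymbol k}$ over all finite sequences $\boldsymbol k$. **Finite type.** $B$ is of finite type if its cluster algebra has finitely many seeds; equivalently, $B$ is mutation-equivalent to an exchange matrix $B'$ whose underlying Cartan matrix ($a_{ii}=2$, $a_{ij}=-|b'_{ij}|$ for $i\ne j$) is of finite type (possibly decomposable). *)

theory Defs
  imports "HOL-Analysis.Analysis"
begin

definition exchange_matrix :: "int^'n^'n \<Rightarrow> bool" where
  "exchange_matrix B \<longleftrightarrow>
     (\<exists>d :: 'n \<Rightarrow> real. (\<forall>i. d i > 0) \<and>
        (\<forall>i j. d i * of_int (B $ i $ j) = - (d j * of_int (B $ j $ i))))"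

definition mutate :: "'n \<Rightarrow> int^'n^'n \<Rightarrow> int^'n^'n" where
  "mutate k B = (\<chi> i j.
     if k = i \<or> k = j then - (B $ i $ j)
     else B $ i $ j + sgn (B $ i $ k) * max (B $ i $ k * B $ k $ j) 0)"

text \<open>A sequence $k_r \cdots k_1$ is the list \<open>[k\<^sub>r, \<dots>, k\<^sub>1]\<close>, in the order in
  which it is written, so its last element acts first.\<close>

definition mutate_seq :: "'n list \<Rightarrow> int^'n^'n \<Rightarrow> int^'n^'n" where
  "mutate_seq ks B = foldr mutate ks B"

text \<open>\<open>eta B k\<close> is the map written $\eta_k^{B^T}$: the last column of the mutation at \<open>k\<close> of
  \<open>B\<close> extended on the right by the column \<open>x\<close>. The transpose appears only in that notation.\<close>

definition eta :: "int^'n^'n \<Rightarrow> 'n \<Rightarrow> real^'n \<Rightarrow> real^'n" where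
  "eta B k x = (\<chi> i.
     if i = k then - (x $ k)
     else x $ i + of_int (sgn (B $ i $ k)) * max (of_int (B $ i $ k) * x $ k) 0)"

fun eta_seq :: "int^'n^'n \<Rightarrow> 'n list \<Rightarrow> real^'n \<Rightarrow> real^'n" where
  "eta_seq B [] = id"
| "eta_seq B (k # ks) = eta (mutate_seq ks B) k \<circ> eta_seq B ks"

definition dominance_region_seq :: "int^'n^'n \<Rightarrow> real^'n \<Rightarrow> 'n list \<Rightarrow> (real^'n) set" where
  "dominance_region_seq B l ks =
     eta_seq B ks -`
       {eta_seq B ks l + map_matrix real_of_int (mutate_seq ks B) *v a | a. \<forall>i. 0 \<le> a $ i}"

definition dominance_region :: "int^'n^'n \<Rightarrow> real^'n \<Rightarrow> (real^'n) set" where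
  "dominance_region B l = (\<Inter>ks. dominance_region_seq B l ks)"

definition cartan_companion :: "int^'n^'n \<Rightarrow> int^'n^'n" where
  "cartan_companion B = (\<chi> i j. if i = j then 2 else - \<bar>B $ i $ j\<bar>)"

text \<open>A possibly decomposable symmetrizable generalized Cartan matrix is of finite type if its
  symmetrization is positive definite. Decomposable matrices need no separate clause; symmetrizers
  differ only by scaling on each indecomposable block, so the choice of \<open>d\<close> is immaterial.\<close>

definition finite_type_cartan :: "int^'n^'n \<Rightarrow> bool" where
  "finite_type_cartan A \<longleftrightarrow>
     (\<forall>i. A $ i $ i = 2) \<and> (\<forall>i j. i \<noteq> j \<longrightarrow> A $ i $ j \<le> 0) \<and>
     (\<exists>d :: 'n \<Rightarrow> real. (\<forall>i. d i > 0) \<and>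
        (\<forall>i j. d i * of_int (A $ i $ j) = d j * of_int (A $ j $ i)) \<and>
        (\<forall>x :: real^'n. x \<noteq> 0 \<longrightarrow>
           (\<Sum>i\<in>UNIV. \<Sum>j\<in>UNIV. d i * of_int (A $ i $ j) * x $ i * x $ j) > 0))"

definition finite_type :: "int^'n^'n \<Rightarrow> bool" where
  "finite_type B \<longleftrightarrow>
     (\<exists>ks. exchange_matrix (mutate_seq ks B) \<and>
           finite_type_cartan (cartan_companion (mutate_seq ks B)))"

end

theory Submission
  imports Defs
begin

text \<open>
  Mutating moves the problem between mutation-equivalent matrices, because the maps \<open>eta\<close> are
  injective. Positive definiteness of the Cartan companion forces the underlying graph to be a
  forest, so mutations at sinks lead to a bipartite \<open>B\<close>. Mutate a bipartite \<open>B\<close> alternately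
  at all vertices of each class. If \<open>y\<close> lies in the dominance region of \<open>l\<close>, then the
  coordinates of the images of \<open>l\<close> and \<open>y\<close> at the class that is about to be mutated differ by a
  nonnegative \<open>\<delta>\<close>, and
  \<open>\<delta> i (t + 2) + \<delta> i t \<le> (\<Sum>k. \<bar>b\<^sub>i\<^sub>k\<bar> * \<delta> k (t + 1))\<close>. Positive definiteness provides weights
  \<open>w > 0\<close> for which \<open>S t = (\<Sum>i. w i * \<delta> i t)\<close> satisfies \<open>S (t + 2) + S t \<le> 2 * c * S (t + 1)\<close>
  with \<open>c < 1\<close>. A nonnegative sequence with this property vanishes, since otherwise the ratios of
  consecutive terms would decrease to minus infinity.
\<close>

section \<open>Transport along mutations\<close>

lemma mutate_seq_Nil [simp]: "mutate_seq [] B = B"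
  and mutate_seq_Cons [simp]: "mutate_seq (k # ks) B = mutate k (mutate_seq ks B)"
  and mutate_seq_append: "mutate_seq (js @ ks) B = mutate_seq js (mutate_seq ks B)"
  by (simp_all add: mutate_seq_def)

lemma eta_seq_append: "eta_seq B (js @ ks) = eta_seq (mutate_seq ks B) js \<circ> eta_seq B ks"
  by (induction js) (simp_all add: mutate_seq_append comp_assoc)

lemma inj_eta: "inj (eta B k)"
proof (rule injI)
  fix x y assume eq: "eta B k x = eta B k y"
  have comp: "eta B k x $ i = eta B k y $ i" for i
    using eq by simp
  have "x $ k = y $ k"
    using comp[of k] by (simp add: eta_def)
  then have "x $ i = y $ i" for i
    using comp[of i] by (cases "i = k") (simp_all add: eta_def)
  then show "x = y"
    by (simp add: vec_eq_iff)
qed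

lemma inj_eta_seq: "inj (eta_seq B ks)"
proof (induction ks)
  case Nil
  then show ?case by simp
next
  case (Cons k ks)
  then show ?case by (simp only: eta_seq.simps inj_compose inj_eta)
qed

lemma mem_dominance_region_iff:
  "y \<in> dominance_region B l \<longleftrightarrow>
     (\<forall>ks. \<exists>a. (\<forall>i. 0 \<le> a $ i) \<and>
        eta_seq B ks y = eta_seq B ks l + map_matrix real_of_int (mutate_seq ks B) *v a)"
  unfolding dominance_region_def dominance_region_seq_def by auto

lemma self_mem_dominance_region: "l \<in> dominance_region B l"
  unfolding mem_dominance_region_iff by (auto intro!: exI[of _ 0])

text \<open>The conditions along \<open>js\<close> for the mutated matrix are those along
  \<open>js @ ks\<close> for \<open>B\<close>.\<close>

lemma eta_seq_mem_dominance_region: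
  assumes "y \<in> dominance_region B l"
  shows "eta_seq B ks y \<in> dominance_region (mutate_seq ks B) (eta_seq B ks l)"
  unfolding mem_dominance_region_iff
proof
  fix js
  show "\<exists>a. (\<forall>i. 0 \<le> a $ i) \<and>
      eta_seq (mutate_seq ks B) js (eta_seq B ks y) =
        eta_seq (mutate_seq ks B) js (eta_seq B ks l) +
        map_matrix real_of_int (mutate_seq js (mutate_seq ks B)) *v a"
    using assms[unfolded mem_dominance_region_iff, rule_format, of "js @ ks"]
    by (simp add: eta_seq_append mutate_seq_append)
qed

lemma dominance_region_subset_singleton_if_mutate_seq:
  assumes "\<And>l. dominance_region (mutate_seq ks B) l \<subseteq> {l}"
  shows "dominance_region B l \<subseteq> {l}"
proof
  fix y assume "y \<in> dominance_region B l"
  then have "eta_seq B ks y \<in> dominance_region (mutate_seq ks B) (eta_seq B ks l)"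
    by (rule eta_seq_mem_dominance_region)
  with assms have "eta_seq B ks y = eta_seq B ks l"
    by blast
  with inj_eta_seq show "y \<in> {l}"
    by (auto dest: injD)
qed

section \<open>Mutation at sinks\<close>

text \<open>The part of skew-symmetrizability that gives edges a direction:
  \<open>0 < B $ i $ j\<close> is read as an edge from \<open>i\<close> to \<open>j\<close>, so a
  sink is an index with nonnegative column.\<close>

definition sign_skew :: "int^'n^'n \<Rightarrow> bool" where
  "sign_skew B \<longleftrightarrow> (\<forall>i j. sgn (B $ i $ j) = - sgn (B $ j $ i))"

lemma sign_skewD:
  assumes "sign_skew B"
  shows "0 < B $ i $ j \<longleftrightarrow> B $ j $ i < 0" "0 \<le> B $ i $ j \<longleftrightarrow> B $ j $ i \<le> 0"
    "B $ i $ i = 0"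
proof -
  have *: "sgn (B $ i $ j) = - sgn (B $ j $ i)" for i j
    using assms unfolding sign_skew_def by blast
  show "0 < B $ i $ j \<longleftrightarrow> B $ j $ i < 0" "0 \<le> B $ i $ j \<longleftrightarrow> B $ j $ i \<le> 0"
    using *[of i j] by (auto simp: sgn_if split: if_splits)
  show "B $ i $ i = 0"
    using *[of i i] by (metis equal_neg_zero sgn_0_0)
qed

lemma sign_skew_zero:
  assumes "sign_skew B" and "0 \<le> B $ i $ j" and "0 \<le> B $ j $ i"
  shows "B $ i $ j = 0"
  using assms(2,3) sign_skewD(2)[OF assms(1), of j i] by simp

lemma sign_skew_if_exchange_matrix:
  assumes "exchange_matrix B"
  shows "sign_skew B"
proof -
  obtain d :: "_ \<Rightarrow> real" where d: "\<And>i. d i > 0"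
    and skew: "\<And>i j. d i * of_int (B $ i $ j) = - (d j * of_int (B $ j $ i))"
    using assms unfolding exchange_matrix_def by blast
  have "sgn (B $ i $ j) = - sgn (B $ j $ i)" for i j
  proof -
    have "sgn (d i * of_int (B $ i $ j)) = - sgn (d j * of_int (B $ j $ i))"
      by (simp add: skew[of i j] sgn_minus)
    then have "sgn (real_of_int (B $ i $ j)) = - sgn (real_of_int (B $ j $ i))"
      using d by (simp add: sgn_mult)
    then show ?thesis
      by (auto simp: sgn_if split: if_splits)
  qed
  then show ?thesis
    unfolding sign_skew_def by blast
qed

text \<open>Conjugation by the diagonal sign matrix that is -1 on \<open>K\<close>: the edges
  between \<open>K\<close> and its complement are reversed.\<close>

definition flip :: "'n set \<Rightarrow> int^'n^'n \<Rightarrow> int^'n^'n" where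
  "flip K B = (\<chi> i j. if (i \<in> K) = (j \<in> K) then B $ i $ j else - (B $ i $ j))"

lemma abs_flip: "\<bar>flip K B $ i $ j\<bar> = \<bar>B $ i $ j\<bar>"
  by (simp add: flip_def)

lemma flip_insert: "k \<notin> K \<Longrightarrow> flip (insert k K) B = flip {k} (flip K B)"
  by (auto simp: flip_def vec_eq_iff)

lemma sign_skew_flip:
  assumes "sign_skew B"
  shows "sign_skew (flip K B)"
  unfolding sign_skew_def
proof (intro allI)
  fix i j
  have "sgn (B $ i $ j) = - sgn (B $ j $ i)"
    using assms unfolding sign_skew_def by blast
  then show "sgn (flip K B $ i $ j) = - sgn (flip K B $ j $ i)"
    by (auto simp: flip_def sgn_minus)
qed

text \<open>A nonnegative column \<open>k\<close> comes with a nonpositive row \<open>k\<close>, so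
  all correction terms of the mutation vanish.\<close>

lemma mutate_sink:
  assumes "sign_skew B" and "\<And>i. 0 \<le> B $ i $ k"
  shows "mutate k B = flip {k} B"
proof -
  have "B $ i $ k * B $ k $ j \<le> 0" for i j
    using assms(2)[of i] assms(2)[of j] sign_skewD(2)[OF assms(1)]
    by (simp add: mult_nonneg_nonpos)
  then have "max (B $ i $ k * B $ k $ j) 0 = 0" for i j
    by (simp add: max_def)
  with sign_skewD(3)[OF assms(1), of k] show ?thesis
    by (auto simp: vec_eq_iff mutate_def flip_def)
qed

text \<open>Two sinks are never adjacent, so the mutations do not interact: each index of
  \<open>ks\<close> is still a sink, with its original coordinate, when its turn comes.\<close>

lemma
  fixes B :: "int^'n^'n"
  assumes "sign_skew B" and "distinct ks" and "\<And>i k. k \<in> set ks \<Longrightarrow> 0 \<le> B $ i $ k"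
  shows mutate_seq_sinks: "mutate_seq ks B = flip (set ks) B"
    and eta_seq_sinks: "eta_seq B ks x =
      (\<chi> i. if i \<in> set ks then - (x $ i)
            else x $ i + (\<Sum>k\<in>set ks. of_int (B $ i $ k) * max (x $ k) 0))"
  using assms(2,3)
proof (induction ks)
  case Nil
  {
    case 1
    then show ?case by (simp add: vec_eq_iff flip_def)
  next
    case 2
    then show ?case by (simp add: vec_eq_iff)
  }
next
  case (Cons k ks)
  have zero: "B $ i $ j = 0"
    if "i \<in> insert k (set ks)" "j \<in> insert k (set ks)"
      "\<And>i j. j \<in> set (k # ks) \<Longrightarrow> 0 \<le> B $ i $ j" for i j
    using that by (intro sign_skew_zero[OF assms(1)]) auto
  {
    case 1
    have IH: "mutate_seq ks B = flip (set ks) B"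
      using 1 by (intro Cons.IH(1)) auto
    have "0 \<le> flip (set ks) B $ i $ k" for i
      using 1 zero[of i k] by (auto simp: flip_def)
    then have "mutate k (flip (set ks) B) = flip {k} (flip (set ks) B)"
      by (intro mutate_sink sign_skew_flip assms(1))
    then show ?case
      using 1(1) by (simp add: IH flip_insert[of k "set ks"])
  next
    case 2
    have IH1: "mutate_seq ks B = flip (set ks) B"
      using 2 by (intro Cons.IH(1)) auto
    have IH2: "eta_seq B ks x =
      (\<chi> i. if i \<in> set ks then - (x $ i)
            else x $ i + (\<Sum>j\<in>set ks. of_int (B $ i $ j) * max (x $ j) 0))"
      using 2 by (intro Cons.IH(2)) auto
    have col: "0 \<le> B $ i $ k" for i
      using 2 by simp
    have "B $ k $ j = 0" "B $ j $ k = 0" if "j \<in> insert k (set ks)" for j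
      using zero[of k j] zero[of j k] that 2(2) by auto
    moreover have "of_int (sgn b) * max (of_int b * r) 0 = of_int b * max r 0"
      if "0 \<le> b" for b :: int and r :: real
      using that by (cases "b = 0") (auto simp: max_def mult_le_0_iff zero_le_mult_iff)
    ultimately show ?case
      using 2(1) col
      by (auto simp: IH1 IH2 eta_def flip_def vec_eq_iff)
  }
qed

section \<open>Bipartite matrices\<close>

text \<open>The indices in \<open>P\<close> are sinks and the others sources; isolated vertices may
  lie in either class.\<close>

definition bipartite :: "int^'n^'n \<Rightarrow> 'n set \<Rightarrow> bool" where
  "bipartite B P \<longleftrightarrow> sign_skew B \<and> (\<forall>i j. 0 < B $ i $ j \<longrightarrow> i \<notin> P \<and> j \<in> P)"

lemma bipartite_uminus:
  assumes "bipartite B P"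
  shows "bipartite (- B) (- P)"
proof -
  have skew: "sign_skew B" and pos: "\<And>i j. 0 < B $ i $ j \<Longrightarrow> i \<notin> P \<and> j \<in> P"
    using assms unfolding bipartite_def by blast+
  have "sgn ((- B) $ i $ j) = - sgn ((- B) $ j $ i)" for i j
    using skew[unfolded sign_skew_def, rule_format, of i j] by (simp add: sgn_minus)
  moreover have "i \<in> P \<and> j \<notin> P" if "0 < (- B) $ i $ j" for i j
    using that pos[of j i] sign_skewD(1)[OF skew, of j i] by simp
  ultimately show ?thesis
    unfolding bipartite_def sign_skew_def by blast
qed

lemma bipartite_nonneg:
  assumes "bipartite B P" and "k \<in> P"
  shows "0 \<le> B $ i $ k"
  using assms sign_skewD(1)[of B k i] unfolding bipartite_def by force

lemma bipartite_zero:
  assumes "bipartite B P" and "i \<in> P \<longleftrightarrow> j \<in> P"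
  shows "B $ i $ j = 0"
proof -
  have "\<not> 0 < B $ i $ j" "\<not> 0 < B $ j $ i"
    using assms unfolding bipartite_def by blast+
  then show ?thesis
    using sign_skewD(1)[of B j i] assms(1) unfolding bipartite_def by force
qed

text \<open>In a row outside \<open>P\<close> the entries are nonnegative in the columns of
  \<open>P\<close> and zero elsewhere. The sum of absolute values over all indices makes the formula
  the same for \<open>B\<close> and \<open>- B\<close>, as the alternating iteration
  requires.\<close>

lemma
  fixes B :: "int^'n^'n"
  assumes "bipartite B P" and "distinct ks" and "set ks = P"
  shows mutate_seq_bipartite: "mutate_seq ks B = - B"
    and eta_seq_bipartite: "eta_seq B ks x =
      (\<chi> i. if i \<in> P then - (x $ i)
            else x $ i + (\<Sum>k\<in>UNIV. \<bar>of_int (B $ i $ k)\<bar> * max (x $ k) 0))"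
proof -
  note sinks = bipartite_nonneg[OF assms(1)]
  have skew: "sign_skew B"
    using assms(1) by (simp add: bipartite_def)
  have "mutate_seq ks B = flip P B"
    using mutate_seq_sinks[OF skew assms(2)] sinks assms(3) by auto
  also have "\<dots> = - B"
    using bipartite_zero[OF assms(1)] by (auto simp: flip_def vec_eq_iff)
  finally show "mutate_seq ks B = - B" .
  have "(\<Sum>k\<in>P. of_int (B $ i $ k) * max (x $ k) 0) =
      (\<Sum>k\<in>UNIV. \<bar>of_int (B $ i $ k)\<bar> * max (x $ k) 0)" if "i \<notin> P" for i
    using that sinks bipartite_zero[OF assms(1)] by (intro sum.mono_neutral_cong_left) auto
  moreover have "eta_seq B ks x =
      (\<chi> i. if i \<in> P then - (x $ i)
            else x $ i + (\<Sum>k\<in>P. of_int (B $ i $ k) * max (x $ k) 0))"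
    unfolding assms(3)[symmetric] by (rule eta_seq_sinks[OF skew assms(2)]) (simp add: assms(3) sinks)
  ultimately show "eta_seq B ks x =
      (\<chi> i. if i \<in> P then - (x $ i)
            else x $ i + (\<Sum>k\<in>UNIV. \<bar>of_int (B $ i $ k)\<bar> * max (x $ k) 0))"
    by (simp add: vec_eq_iff)
qed

text \<open>The empty sequence makes \<open>y - l\<close> the image under \<open>B\<close> of a
  nonnegative vector, and the row of a sink is nonpositive.\<close>

lemma dominance_region_le_at_sink:
  assumes "y \<in> dominance_region B l" and "bipartite B P" and "k \<in> P"
  shows "y $ k \<le> l $ k"
proof -
  obtain a where a: "\<And>i. 0 \<le> a $ i" and y: "y = l + map_matrix real_of_int B *v a"
    using assms(1)[unfolded mem_dominance_region_iff, rule_format, of "[]"] by auto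
  have "B $ k $ j \<le> 0" for j
    using bipartite_nonneg[OF assms(2,3), of j] sign_skewD(2)[of B j k] assms(2)
    by (simp add: bipartite_def)
  then have "(map_matrix real_of_int B *v a) $ k \<le> 0"
    using a by (auto simp: matrix_vector_mult_def map_matrix_def intro!: sum_nonpos mult_nonpos_nonneg)
  then show ?thesis
    by (simp add: y)
qed

text \<open>If \<open>r\<close> is one ratio, the next is at most \<open>2 * c - 1 / r\<close>,
  which by \<open>2 \<le> r + 1 / r\<close> lies at least \<open>2 - 2 * c\<close> below
  \<open>r\<close>. For \<open>c = 1\<close>, constant sequences satisfy the recurrence.\<close>

lemma nonneg_recurrence_imp_zero:
  fixes S :: "nat \<Rightarrow> real"
  assumes nonneg: "\<And>t. 0 \<le> S t" and rec: "\<And>t. S (Suc (Suc t)) + S t \<le> 2 * c * S (Suc t)"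
    and "c < 1"
  shows "S t = 0"
proof (rule ccontr)
  assume "S t \<noteq> 0"
  define R where "R n = S (n + t)" for n
  have R: "R (Suc (Suc n)) + R n \<le> 2 * c * R (Suc n)" for n
    using rec by (simp add: R_def)
  have pos: "0 < R n" for n
  proof (induction n)
    case 0
    then show ?case using \<open>S t \<noteq> 0\<close> nonneg[of t] by (simp add: R_def)
  next
    case (Suc n)
    \<comment> \<open>A vanishing term would give \<open>R (Suc (Suc n)) + R n \<le> 0\<close>,
      against \<open>0 < R n\<close>.\<close>
    have "R (Suc n) \<noteq> 0"
      using R[of n] Suc nonneg[of "Suc (Suc n) + t"] by (auto simp: R_def)
    then show ?case
      using nonneg[of "Suc n + t"] by (simp add: R_def)
  qed
  have "R (Suc n) / R n \<le> R (Suc 0) / R 0 - real n * (2 - 2 * c)" for n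
  proof (induction n)
    case 0
    then show ?case by simp
  next
    case (Suc n)
    define r where "r = R (Suc n) / R n"
    have "0 < r"
      using pos by (simp add: r_def)
    have "R (Suc (Suc n)) / R (Suc n) \<le> (2 * c * R (Suc n) - R n) / R (Suc n)"
      using R[of n] pos[of "Suc n"] by (intro divide_right_mono) auto
    also have "\<dots> = 2 * c - 1 / r"
      using pos[of "Suc n"] by (simp add: r_def diff_divide_distrib)
    also have "\<dots> \<le> r - (2 - 2 * c)"
    proof -
      have "2 * r \<le> r * r + 1"
        using zero_le_square[of "r - 1"] by (simp add: algebra_simps)
      then have "2 \<le> r + 1 / r"
        using \<open>0 < r\<close> by (simp add: field_simps)
      then show ?thesis by simp
    qed
    finally show ?case
      using Suc by (simp add: r_def algebra_simps)
  qed
  moreover obtain n where "R (Suc 0) / R 0 < real n * (2 - 2 * c)"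
    using reals_Archimedean3[of "2 - 2 * c"] \<open>c < 1\<close> by auto
  ultimately have "R (Suc n) / R n < 0"
    by (meson diff_less_0_iff_less order_le_less_trans)
  then show False
    using pos[of n] pos[of "Suc n"] by (simp add: divide_less_0_iff)
qed

text \<open>\<open>dom\<close> says that the row vector \<open>w\<close> times the Cartan companion
  of \<open>B\<close> is positive; positive definiteness enters in this form.\<close>

lemma bipartite_dominance_region_subset_singleton:
  fixes B :: "int^'n^'n"
  assumes bip: "bipartite B P" and w: "\<And>i. 0 < w i"
    and dom: "\<And>k. (\<Sum>i\<in>UNIV. w i * \<bar>of_int (B $ i $ k)\<bar>) < 2 * (w k :: real)"
  shows "dominance_region B l \<subseteq> {l}"
proof
  fix y assume y: "y \<in> dominance_region B l"
  obtain ps where ps: "distinct ps" "set ps = P"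
    using finite_distinct_list[of P] by auto
  obtain qs where qs: "distinct qs" "set qs = - P"
    using finite_distinct_list[of "- P"] by auto
  \<comment> \<open>New blocks go to the front because lists act from the back. After
    \<open>t\<close> blocks the matrix is \<open>C t\<close>, its sink class is \<open>Q t\<close>,
    and \<open>X t x\<close> is the image of \<open>x\<close>.\<close>
  define K where "K = rec_nat [] (\<lambda>t ks. (if even t then ps else qs) @ ks)"
  define Q where "Q t = (if even t then P else - P)" for t :: nat
  define C where "C t = (if even t then B else - B)" for t :: nat
  define X where "X t x = eta_seq B (K t) x" for t x
  have K: "K 0 = []" "K (Suc t) = (if even t then ps else qs) @ K t" for t
    by (simp_all add: K_def)
  have C: "bipartite (C t) (Q t)" for t
    using bip bipartite_uminus[OF bip] by (simp add: C_def Q_def)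
  have Q: "distinct (if even t then ps else qs)" "set (if even t then ps else qs) = Q t"
    and Q_Suc: "Q (Suc t) = - Q t" for t
    using ps qs by (simp_all add: Q_def)
  have mut: "mutate_seq (K t) B = C t" for t
  proof (induction t)
    case 0
    then show ?case by (simp add: K C_def)
  next
    case (Suc t)
    have "mutate_seq (K (Suc t)) B = - C t"
      unfolding K mutate_seq_append Suc by (rule mutate_seq_bipartite[OF C Q])
    then show ?case by (simp add: C_def)
  qed
  have X0: "X 0 x = x" for x
    by (simp add: X_def K)
  have X_Suc: "X (Suc t) x $ i = (if i \<in> Q t then - (X t x $ i)
      else X t x $ i + (\<Sum>k\<in>UNIV. \<bar>of_int (B $ i $ k)\<bar> * max (X t x $ k) 0))" for t x i
  proof -
    have "X (Suc t) x = eta_seq (C t) (if even t then ps else qs) (X t x)"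
      unfolding X_def K eta_seq_append mut by simp
    then show ?thesis
      unfolding eta_seq_bipartite[OF C Q] by (simp add: C_def)
  qed
  define \<delta> where "\<delta> i t = X t l $ i - X t y $ i" for i t
  have \<delta>_nonneg: "0 \<le> \<delta> i t" if "i \<in> Q t" for i t
    using dominance_region_le_at_sink[OF eta_seq_mem_dominance_region[OF y, of "K t"], unfolded mut,
        OF C that]
    by (simp add: \<delta>_def X_def)
  have \<delta>_rec: "\<delta> i (Suc (Suc t)) + \<delta> i t \<le> (\<Sum>k\<in>Q (Suc t). \<bar>of_int (B $ i $ k)\<bar> * \<delta> k (Suc t))"
    if i: "i \<in> Q t" for i t
  proof -
    \<comment> \<open>Round \<open>t\<close> only negates coordinate \<open>i\<close> and round
      \<open>t + 1\<close> adds the sum to it, so \<open>\<delta> i t\<close> returns with a minus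
      sign.\<close>
    have "\<delta> i (Suc (Suc t)) + \<delta> i t =
        (\<Sum>k\<in>UNIV. \<bar>of_int (B $ i $ k)\<bar> * (max (X (Suc t) l $ k) 0 - max (X (Suc t) y $ k) 0))"
      using i by (simp add: \<delta>_def X_Suc[of "Suc t"] X_Suc[of t _ i] Q_Suc sum_subtractf right_diff_distrib)
    also have "\<dots> = (\<Sum>k\<in>Q (Suc t).
        \<bar>of_int (B $ i $ k)\<bar> * (max (X (Suc t) l $ k) 0 - max (X (Suc t) y $ k) 0))"
      using i bipartite_zero[OF bip, of i]
      by (intro sum.mono_neutral_right) (auto simp: Q_def split: if_splits)
    \<comment> \<open>The positive part is 1-Lipschitz, and the differences
      \<open>\<delta> k (Suc t)\<close> are nonnegative on \<open>Q (Suc t)\<close>.\<close>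
    also have "\<dots> \<le> (\<Sum>k\<in>Q (Suc t). \<bar>of_int (B $ i $ k)\<bar> * \<delta> k (Suc t))"
      using \<delta>_nonneg by (intro sum_mono mult_left_mono) (force simp: \<delta>_def max_def)+
    finally show ?thesis .
  qed
  \<comment> \<open>The strict inequalities \<open>dom\<close> are finitely many, so they hold with
    a common factor below 1.\<close>
  obtain c where c: "c < 1" and cw: "\<And>k. (\<Sum>i\<in>UNIV. w i * \<bar>of_int (B $ i $ k)\<bar>) \<le> 2 * c * w k"
  proof
    define q where "q k = (\<Sum>i\<in>UNIV. w i * \<bar>of_int (B $ i $ k)\<bar>) / (2 * w k)" for k
    show "Max (range q) < 1"
      using dom w by (auto simp: q_def)
    show "(\<Sum>i\<in>UNIV. w i * \<bar>of_int (B $ i $ k)\<bar>) \<le> 2 * Max (range q) * w k" for k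
    proof -
      have "q k \<le> Max (range q)"
        by simp
      then have "q k * (2 * w k) \<le> Max (range q) * (2 * w k)"
        using w[of k] by (intro mult_right_mono) auto
      then show ?thesis
        using w[of k] by (simp add: q_def algebra_simps)
    qed
  qed
  have w_nonneg: "0 \<le> w i" for i
    using w[of i] by simp
  define S where "S t = (\<Sum>i\<in>Q t. w i * \<delta> i t)" for t
  have "0 \<le> S t" for t
    by (simp add: S_def sum_nonneg w_nonneg \<delta>_nonneg)
  moreover have "S (Suc (Suc t)) + S t \<le> 2 * c * S (Suc t)" for t
  proof -
    have "S (Suc (Suc t)) + S t = (\<Sum>i\<in>Q t. w i * (\<delta> i (Suc (Suc t)) + \<delta> i t))"
      by (simp add: S_def Q_Suc sum.distrib distrib_left)
    also have "\<dots> \<le> (\<Sum>i\<in>Q t. w i * (\<Sum>k\<in>Q (Suc t). \<bar>of_int (B $ i $ k)\<bar> * \<delta> k (Suc t)))"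
      by (intro sum_mono mult_left_mono \<delta>_rec w_nonneg)
    also have "\<dots> = (\<Sum>k\<in>Q (Suc t). (\<Sum>i\<in>Q t. w i * \<bar>of_int (B $ i $ k)\<bar>) * \<delta> k (Suc t))"
      unfolding sum_distrib_left sum_distrib_right
      by (subst sum.swap) (simp add: mult.assoc)
    also have "\<dots> \<le> (\<Sum>k\<in>Q (Suc t). (2 * c * w k) * \<delta> k (Suc t))"
    proof (intro sum_mono mult_right_mono \<delta>_nonneg)
      fix k
      have "(\<Sum>i\<in>Q t. w i * \<bar>real_of_int (B $ i $ k)\<bar>) \<le> (\<Sum>i\<in>UNIV. w i * \<bar>of_int (B $ i $ k)\<bar>)"
        by (intro sum_mono2) (simp_all add: w_nonneg)
      with cw[of k] show "(\<Sum>i\<in>Q t. w i * \<bar>of_int (B $ i $ k)\<bar>) \<le> 2 * c * w k"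
        by linarith
    qed
    also have "\<dots> = 2 * c * S (Suc t)"
      by (simp add: S_def sum_distrib_left mult.assoc)
    finally show ?thesis .
  qed
  ultimately have "S t = 0" for t
    using nonneg_recurrence_imp_zero c by blast
  then have "\<forall>i\<in>Q t. w i * \<delta> i t = 0" for t
    unfolding S_def by (subst sum_nonneg_eq_0_iff[symmetric]) (simp_all add: w_nonneg \<delta>_nonneg)
  then have \<delta>_zero: "\<delta> i t = 0" if "i \<in> Q t" for i t
    using that w[of i] by force
  have on_P: "l $ i = y $ i" if "i \<in> P" for i
    using \<delta>_zero[of i 0] that by (simp add: \<delta>_def X0 Q_def)
  \<comment> \<open>Round 0 shifts these coordinates by sums over \<open>P\<close>, where
    \<open>l\<close> and \<open>y\<close> already agree; hence \<open>\<delta> i 1\<close> is still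
    the original difference.\<close>
  have "l $ i = y $ i" if "i \<notin> P" for i
  proof -
    have "(\<Sum>k\<in>UNIV. \<bar>of_int (B $ i $ k)\<bar> * max (l $ k) 0) =
        (\<Sum>k\<in>UNIV. \<bar>of_int (B $ i $ k)\<bar> * max (y $ k) 0)"
    proof (rule sum.cong)
      fix k
      show "\<bar>of_int (B $ i $ k)\<bar> * max (l $ k) 0 = \<bar>of_int (B $ i $ k)\<bar> * max (y $ k) 0"
        using on_P bipartite_zero[OF bip, of i k] that by (cases "k \<in> P") simp_all
    qed simp
    then show ?thesis
      using \<delta>_zero[of i 1] that by (simp add: \<delta>_def X0 Q_def X_Suc[of 0])
  qed
  with on_P have "l $ i = y $ i" for i
    by blast
  then show "y \<in> {l}"
    by (simp add: vec_eq_iff)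
qed

section \<open>Forests\<close>

text \<open>\<open>h\<close> drops by one along each edge, so a vertex of least height is a sink.
  Mutating there and raising it by two preserves all hypotheses; once every height is at least
  \<open>M - 1\<close>, the matrix is bipartite.\<close>

lemma height_dominance_region_subset_singleton:
  fixes B :: "int^'n^'n" and h :: "'n \<Rightarrow> nat"
  assumes "sign_skew B" and "\<And>i. 0 < w i"
    and "\<And>k. (\<Sum>i\<in>UNIV. w i * \<bar>of_int (B $ i $ k)\<bar>) < 2 * (w k :: real)"
    and "\<And>i j. 0 < B $ i $ j \<Longrightarrow> h i = Suc (h j)"
    and "\<And>i. h i \<le> M"
  shows "dominance_region B l \<subseteq> {l}"
  using assms
proof (induction "\<Sum>i\<in>UNIV. M - h i" arbitrary: B h l rule: less_induct)
  case less
  show ?case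
  proof (cases "\<forall>i. M \<le> Suc (h i)")
    case True
    \<comment> \<open>An edge can now lead only from height \<open>M\<close> to height
      \<open>M - 1\<close>.\<close>
    have "i \<notin> {k. h k \<noteq> M} \<and> j \<in> {k. h k \<noteq> M}" if "0 < B $ i $ j" for i j
      using less.prems(4)[OF that] less.prems(5)[of i] True[rule_format, of j] by auto
    then have "bipartite B {k. h k \<noteq> M}"
      using less.prems(1) unfolding bipartite_def by blast
    then show ?thesis
      by (rule bipartite_dominance_region_subset_singleton) (fact less.prems)+
  next
    case False
    then obtain i where i: "Suc (h i) < M"
      by (auto simp: not_le)
    obtain k where k: "\<And>j. h k \<le> h j"
      using ex_has_least_nat[of "\<lambda>_. True" i h] by blast
    have kM: "Suc (h k) < M"
      using i k[of i] by simp
    have sink: "0 \<le> B $ j $ k" for j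
      using sign_skewD(1)[OF less.prems(1), of k j] less.prems(4)[of k j] k[of j] by force
    \<comment> \<open>The neighbours of \<open>k\<close> have height \<open>h k + 1\<close>; adding
      two puts \<open>k\<close> just above them, as the reversed edges demand.\<close>
    define h' where "h' = h(k := h k + 2)"
    have mut: "mutate_seq [k] B = flip {k} B"
      using mutate_sink[OF less.prems(1) sink] by simp
    show ?thesis
    proof (rule dominance_region_subset_singleton_if_mutate_seq[where ks = "[k]"], unfold mut,
        rule less.hyps[of h'])
      show "(\<Sum>i\<in>UNIV. M - h' i) < (\<Sum>i\<in>UNIV. M - h i)"
        using kM by (intro sum_strict_mono_ex1) (auto simp: h'_def intro!: bexI[of _ k])
      show "sign_skew (flip {k} B)"
        by (rule sign_skew_flip) (fact less.prems)
      show "(\<Sum>i\<in>UNIV. w i * \<bar>of_int (flip {k} B $ i $ j)\<bar>) < 2 * w j" for j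
        using less.prems(3)[of j] by (simp add: abs_flip flip: of_int_abs)
      show "h' i \<le> M" for i
        using less.prems(5) kM by (simp add: h'_def)
      show "h' i = Suc (h' j)" if pos: "0 < flip {k} B $ i $ j" for i j
      proof -
        consider "i = k" "j \<noteq> k" "0 < B $ j $ k" | "i \<noteq> k" "j \<noteq> k" "0 < B $ i $ j"
          using pos sink[of i] sign_skewD(1)[OF less.prems(1), of j k] sign_skewD(3)[OF less.prems(1)]
          by (auto simp: flip_def split: if_splits)
        then show ?thesis
          by cases (auto simp: h'_def dest: less.prems(4))
      qed
    qed (fact less.prems(2))
  qed
qed

text \<open>\<open>leaf\<close> characterises forests. Remove a vertex with at most one neighbour,
  grade the rest, and put the vertex one above or below its neighbour according to the direction of
  the edge.\<close>

lemma height_function_exists: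
  fixes B :: "int^'n^'n"
  assumes "sign_skew B"
    and leaf: "\<And>S :: 'n set. S \<noteq> {} \<Longrightarrow> \<exists>v\<in>S. card {j\<in>S. B $ v $ j \<noteq> 0} \<le> 1"
  obtains h :: "'n \<Rightarrow> nat" where "\<And>i j. 0 < B $ i $ j \<Longrightarrow> h i = Suc (h j)"
proof -
  \<comment> \<open>Heights are integers at first, since a leaf may have to go below all other
    vertices; the minimum is subtracted at the end.\<close>
  have "\<exists>h :: 'n \<Rightarrow> int. \<forall>i\<in>S. \<forall>j\<in>S. 0 < B $ i $ j \<longrightarrow> h i = h j + 1" if "finite S" for S
    using that
  proof (induction S rule: finite_psubset_induct)
    case (psubset S)
    show ?case
    proof (cases "S = {}")
      case True
      then show ?thesis by simp
    next
      case False
      then obtain v where v: "v \<in> S" "card {j\<in>S. B $ v $ j \<noteq> 0} \<le> 1"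
        using leaf by blast
      then have "S - {v} \<subset> S"
        by blast
      with psubset.IH obtain h :: "'n \<Rightarrow> int"
        where h: "\<forall>i\<in>S - {v}. \<forall>j\<in>S - {v}. 0 < B $ i $ j \<longrightarrow> h i = h j + 1"
        by blast
      \<comment> \<open>If \<open>v\<close> has no neighbour in \<open>S\<close>, then
        \<open>u\<close> is arbitrary and no edge condition involves \<open>v\<close>.\<close>
      obtain u where u: "\<And>j. j \<in> S \<Longrightarrow> B $ v $ j \<noteq> 0 \<Longrightarrow> j = u"
        using v(2) by (auto simp: card_le_Suc0_iff_eq) metis
      have vu: "j = u" "j \<noteq> v" if "j \<in> S" "0 < B $ v $ j \<or> 0 < B $ j $ v" for j
        using that u[of j] sign_skewD(1)[OF assms(1), of j v] sign_skewD(3)[OF assms(1), of v]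
        by force+
      have "\<forall>i\<in>S. \<forall>j\<in>S. 0 < B $ i $ j \<longrightarrow>
          (h(v := h u + sgn (B $ v $ u))) i = (h(v := h u + sgn (B $ v $ u))) j + 1"
      proof (intro ballI impI)
        fix i j assume ij: "i \<in> S" "j \<in> S" "0 < B $ i $ j"
        consider "i = v" "j = u" "u \<noteq> v" | "i = u" "j = v" "u \<noteq> v" | "i \<noteq> v" "j \<noteq> v"
          using vu[of i] vu[of j] ij by metis
        then show "(h(v := h u + sgn (B $ v $ u))) i = (h(v := h u + sgn (B $ v $ u))) j + 1"
          using ij h sign_skewD(1)[OF assms(1), of u v] by cases (auto simp: sgn_if)
      qed
      then show ?thesis by blast
    qed
  qed
  from this[of UNIV] obtain h :: "'n \<Rightarrow> int"
    where h: "\<And>i j. 0 < B $ i $ j \<Longrightarrow> h i = h j + 1"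
    by auto
  define m where "m = Min (range h)"
  have "m \<le> h i" for i
    by (simp add: m_def)
  then have "nat (h i - m) = Suc (nat (h j - m))" if "0 < B $ i $ j" for i j
    using h[OF that] by (smt (verit) Suc_nat_eq_nat_zadd1)
  then show thesis
    by (rule that)
qed

section \<open>Cartan matrices of finite type\<close>

text \<open>The symmetrized form is evaluated at \<open>x i = 1 / sqrt (d i)\<close> on \<open>S\<close>: each edge inside \<open>S\<close>
  contributes at most \<open>-2\<close>, so a subgraph with all degrees at least \<open>2\<close> would make the value
  nonpositive.\<close>

lemma finite_type_cartan_leaf:
  fixes A :: "int^'n^'n"
  assumes "finite_type_cartan A" and "S \<noteq> {}"
  shows "\<exists>v\<in>S. card {j\<in>S. j \<noteq> v \<and> A $ v $ j \<noteq> 0} \<le> 1"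
proof (rule ccontr)
  assume "\<not> ?thesis"
  then have deg: "2 \<le> card {j\<in>S. j \<noteq> v \<and> A $ v $ j \<noteq> 0}" if "v \<in> S" for v
    using that by force
  obtain d :: "'n \<Rightarrow> real" where diag: "\<And>i. A $ i $ i = 2"
    and off: "\<And>i j. i \<noteq> j \<Longrightarrow> A $ i $ j \<le> 0"
    and d: "\<And>i. 0 < d i"
    and sym: "\<And>i j. d i * of_int (A $ i $ j) = d j * of_int (A $ j $ i)"
    and posdef: "\<And>x :: real^'n. x \<noteq> 0 \<Longrightarrow>
      0 < (\<Sum>i\<in>UNIV. \<Sum>j\<in>UNIV. d i * of_int (A $ i $ j) * x $ i * x $ j)"
    using assms(1) unfolding finite_type_cartan_def by blast
  define x :: "real^'n" where "x = (\<chi> i. if i \<in> S then 1 / sqrt (d i) else 0)"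
  \<comment> \<open>The symmetric normalization of \<open>A\<close>: \<open>m i j * m j i\<close>
    equals \<open>A $ i $ j * A $ j $ i\<close>, so integrality forces nonzero off-diagonal entries
    to be at most -1.\<close>
  define m where "m i j = d i * of_int (A $ i $ j) / (sqrt (d i) * sqrt (d j))" for i j
  have m_diag: "m i i = 2" for i
    using d[of i] by (simp add: m_def diag)
  have m_nonpos: "m i j \<le> 0" if "i \<noteq> j" for i j
    using off[OF that] d[of i] d[of j]
    by (simp add: m_def divide_nonpos_pos mult_nonneg_nonpos)
  have m_edge: "m i j \<le> -1" if ij: "i \<noteq> j" "A $ i $ j \<noteq> 0" for i j
  proof -
    have "A $ j $ i \<noteq> 0"
      using sym[of i j] d[of i] ij(2) by auto
    then have "A $ i $ j \<le> - 1" "A $ j $ i \<le> - 1"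
      using off[of i j] off[of j i] ij by auto
    then have prod: "1 \<le> real_of_int (A $ i $ j) * of_int (A $ j $ i)"
      using mult_mono[of 1 "- real_of_int (A $ i $ j)" 1 "- real_of_int (A $ j $ i)"] by linarith
    have "m i j = m j i"
      by (simp add: m_def sym[of i j] mult.commute)
    then have "m i j * m i j = m i j * m j i"
      by simp
    also have "\<dots> = of_int (A $ i $ j) * of_int (A $ j $ i)"
      using d[of i] d[of j] by (simp add: m_def field_simps flip: power2_eq_square)
    finally have "1 \<le> (m i j)\<^sup>2"
      using prod by (simp add: power2_eq_square)
    then have "1 \<le> \<bar>m i j\<bar>"
      using abs_le_square_iff[of 1 "m i j"] by simp
    then show ?thesis
      using m_nonpos[OF ij(1)] by linarith
  qed
  have "(\<Sum>j\<in>S. m i j) \<le> 0" if "i \<in> S" for i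
  proof -
    define E where "E = {j\<in>S. j \<noteq> i \<and> A $ i $ j \<noteq> 0}"
    have "(\<Sum>j\<in>S - {i}. m i j) \<le> (\<Sum>j\<in>E. m i j)"
      using sum.subset_diff[of E "S - {i}" "m i"] m_nonpos
        sum_nonpos[of "S - {i} - E" "m i"] by (force simp: E_def)
    also have "\<dots> \<le> (\<Sum>j\<in>E. - 1)"
      using m_edge by (intro sum_mono) (auto simp: E_def)
    also have "\<dots> \<le> - 2"
      using deg[OF that] by (simp add: E_def)
    finally show ?thesis
      using that m_diag[of i] sum.remove[of S i "m i"] by simp
  qed
  then have "(\<Sum>i\<in>S. \<Sum>j\<in>S. m i j) \<le> 0"
    by (simp add: sum_nonpos)
  moreover have "(\<Sum>i\<in>UNIV. \<Sum>j\<in>UNIV. d i * of_int (A $ i $ j) * x $ i * x $ j) =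
      (\<Sum>i\<in>S. \<Sum>j\<in>S. m i j)"
  proof -
    have "(\<Sum>j\<in>UNIV. d i * of_int (A $ i $ j) * x $ i * x $ j) =
        (if i \<in> S then \<Sum>j\<in>S. m i j else 0)" for i
      by (auto simp: x_def m_def intro!: sum.mono_neutral_cong_right)
    then show ?thesis
      by (simp flip: sum.inter_restrict[of UNIV, simplified])
  qed
  moreover have "x \<noteq> 0"
    using assms(2) d by (auto simp: x_def vec_eq_iff) (metis less_irrefl)
  ultimately show False
    using posdef[of x] by simp
qed

text \<open>With \<open>M = (d i * A $ i $ j)\<close> symmetric positive definite and \<open>M *v v = 1\<close>, the weights
  \<open>w i = d i * v i\<close> work. The vector \<open>v\<close> is nonnegative because its negative part \<open>p\<close> satisfies
  \<open>p \<bullet> (M *v p) \<le> 0\<close>.\<close>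

lemma finite_type_cartan_weights:
  fixes A :: "int^'n^'n"
  assumes "finite_type_cartan A"
  obtains w :: "'n \<Rightarrow> real"
  where "\<And>i. 0 < w i" "\<And>k. 0 < (\<Sum>i\<in>UNIV. w i * of_int (A $ i $ k))"
proof -
  obtain d :: "'n \<Rightarrow> real" where diag: "\<And>i. A $ i $ i = 2"
    and off: "\<And>i j. i \<noteq> j \<Longrightarrow> A $ i $ j \<le> 0"
    and d: "\<And>i. 0 < d i"
    and sym: "\<And>i j. d i * of_int (A $ i $ j) = d j * of_int (A $ j $ i)"
    and posdef: "\<And>x :: real^'n. x \<noteq> 0 \<Longrightarrow>
      0 < (\<Sum>i\<in>UNIV. \<Sum>j\<in>UNIV. d i * of_int (A $ i $ j) * x $ i * x $ j)"
    using assms unfolding finite_type_cartan_def by blast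
  define M :: "real^'n^'n" where "M = (\<chi> i j. d i * of_int (A $ i $ j))"
  have form: "x \<bullet> (M *v x) = (\<Sum>i\<in>UNIV. \<Sum>j\<in>UNIV. d i * of_int (A $ i $ j) * x $ i * x $ j)" for x
    by (simp add: M_def inner_vec_def matrix_vector_mult_def sum_distrib_left mult_ac)
  have M_off: "M $ i $ j \<le> 0" if "i \<noteq> j" for i j
    using off[OF that] d[of i] by (simp add: M_def mult_nonneg_nonpos)
  have "x = 0" if "M *v x = 0" for x
    using posdef[of x] form[of x] that by auto
  then have "surj ((*v) M)"
    by (metis matrix_left_invertible_ker matrix_left_right_inverse matrix_right_invertible_surjective)
  then obtain v where v: "M *v v = 1"
    by (metis surjD)
  define p where "p = (\<chi> i. max (- (v $ i)) 0)"
  have "p \<bullet> (M *v p) \<le> 0"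
  proof -
    \<comment> \<open>\<open>v + p\<close> is the positive part of \<open>v\<close>. It vanishes
      wherever \<open>p\<close> does not, so there only off-diagonal entries of the row
      contribute.\<close>
    have "p $ i * (M *v (v + p)) $ i \<le> 0" for i
    proof (cases "0 \<le> v $ i")
      case True
      then show ?thesis by (simp add: p_def)
    next
      case False
      have "M $ i $ j * (v + p) $ j \<le> 0" for j
        using False M_off[of i j] by (cases "j = i") (auto simp: p_def max_def mult_nonpos_nonneg)
      then have "(M *v (v + p)) $ i \<le> 0"
        by (simp add: matrix_vector_mult_def sum_nonpos)
      moreover have "0 \<le> p $ i"
        by (simp add: p_def)
      ultimately show ?thesis
        by (simp add: mult_nonneg_nonpos)
    qed
    then have "p \<bullet> (M *v (v + p)) \<le> 0"
      by (simp add: inner_vec_def sum_nonpos)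
    moreover have "0 \<le> p \<bullet> (M *v v)"
      by (simp add: v inner_vec_def p_def sum_nonneg)
    ultimately show ?thesis
      by (simp add: matrix_vector_right_distrib inner_add_right)
  qed
  then have "p = 0"
    using posdef[of p] form[of p] by force
  then have v_nonneg: "0 \<le> v $ i" for i
    by (simp add: p_def vec_eq_iff max_def split: if_splits) (metis not_le_imp_less less_imp_le)
  have Mv: "(\<Sum>j\<in>UNIV. M $ k $ j * v $ j) = 1" for k
    using arg_cong[OF v, of "\<lambda>u. u $ k"] by (simp add: matrix_vector_mult_def)
  have "0 < d i * v $ i" for i
  proof -
    \<comment> \<open>Otherwise the diagonal term of row \<open>i\<close> vanishes and the row sum
      is nonpositive instead of 1.\<close>
    have "v $ i \<noteq> 0"
    proof
      assume "v $ i = 0"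
      then have "M $ i $ j * v $ j \<le> 0" for j
        using M_off[of i j] v_nonneg[of j] by (cases "j = i") (auto simp: mult_nonpos_nonneg)
      then show False
        using Mv[of i] sum_nonpos[of UNIV "\<lambda>j. M $ i $ j * v $ j"] by simp
    qed
    then show ?thesis
      using v_nonneg[of i] d[of i] by (simp add: zero_less_mult_iff)
  qed
  moreover have "0 < (\<Sum>i\<in>UNIV. d i * v $ i * of_int (A $ i $ k))" for k
  proof -
    \<comment> \<open>Symmetry of \<open>M\<close> turns the column sum into a row sum.\<close>
    have "(\<Sum>i\<in>UNIV. d i * v $ i * of_int (A $ i $ k)) = (\<Sum>j\<in>UNIV. M $ k $ j * v $ j)"
      using sym[of _ k] by (intro sum.cong) (auto simp: M_def mult_ac)
    then show ?thesis
      by (simp add: Mv)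
  qed
  ultimately show thesis
    by (rule that)
qed

text \<open>\<open>B\<close> and its companion have the same off-diagonal support and
  \<open>B\<close> has zero diagonal, so the leaf property and the weights pass from the companion
  to \<open>B\<close>.\<close>

lemma finite_type_cartan_dominance_region_subset_singleton:
  fixes B :: "int^'n^'n"
  assumes "exchange_matrix B" and cartan: "finite_type_cartan (cartan_companion B)"
  shows "dominance_region B l \<subseteq> {l}"
proof -
  have skew: "sign_skew B"
    using assms(1) by (rule sign_skew_if_exchange_matrix)
  note B_diag = sign_skewD(3)[OF skew]
  obtain w :: "'n \<Rightarrow> real" where w: "\<And>i. 0 < w i"
    and wA: "\<And>k. 0 < (\<Sum>i\<in>UNIV. w i * of_int (cartan_companion B $ i $ k))"
    using finite_type_cartan_weights[OF cartan] by blast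
  have wB: "(\<Sum>i\<in>UNIV. w i * \<bar>of_int (B $ i $ k)\<bar>) < 2 * w k" for k
  proof -
    have "(\<Sum>i\<in>UNIV. w i * of_int (cartan_companion B $ i $ k)) =
        (\<Sum>i\<in>UNIV. (if i = k then 2 * w k else 0) - w i * \<bar>of_int (B $ i $ k)\<bar>)"
      by (intro sum.cong) (auto simp: cartan_companion_def B_diag)
    then show ?thesis
      using wA[of k] by (simp add: sum_subtractf)
  qed
  have "\<exists>v\<in>S. card {j\<in>S. B $ v $ j \<noteq> 0} \<le> 1" if "S \<noteq> {}" for S
  proof -
    have "{j\<in>S. j \<noteq> v \<and> cartan_companion B $ v $ j \<noteq> 0} = {j\<in>S. B $ v $ j \<noteq> 0}" for v
      using B_diag by (auto simp: cartan_companion_def)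
    with finite_type_cartan_leaf[OF cartan that] show ?thesis
      by simp
  qed
  then obtain h :: "'n \<Rightarrow> nat" where h: "\<And>i j. 0 < B $ i $ j \<Longrightarrow> h i = Suc (h j)"
    using height_function_exists[OF skew] by blast
  show ?thesis
    using height_dominance_region_subset_singleton[OF skew w wB h, where M = "Max (range h)"] by simp
qed

theorem theorem3p2:
  fixes B :: "int^'n^'n"
  assumes "exchange_matrix B"
    and "finite_type B"
  shows "\<forall>l :: real^'n. dominance_region B l = {l}"
proof -
  obtain ks where "exchange_matrix (mutate_seq ks B)"
    and "finite_type_cartan (cartan_companion (mutate_seq ks B))"
    using assms(2) unfolding finite_type_def by blast
  \<comment> \<open>The bound at the representative with finite type companion is pulled back to
    \<open>B\<close>.\<close>
  then have "dominance_region B l \<subseteq> {l}" for l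
    by (rule dominance_region_subset_singleton_if_mutate_seq
        [OF finite_type_cartan_dominance_region_subset_singleton])
  then show ?thesis
    using self_mem_dominance_region by blast
qed

end
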